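(* Let $\kappa<\lambda_0<\lambda_1$ be regular cardinals and let $U$ be an ultrafilter over $\kappa$ which is a simple $P_{\lambda_0\times\lambda_1}$-point. Then $U$ is neither $(\lambda_0,\lambda_0)$-cohesive nor $(\lambda_1,\lambda_1)$-cohesive, but $U$ is $(\lambda_0,\lambda_1)$-cohesive.
   Context: $A\subseteq^*B$ means $A\setminus B$ is bounded in $\kappa$. $U$ is a simple $P_{\lambda_0\times\lambda_1}$-point if there is $\mathcal{B}\subseteq U$ such that every $A\in U$ has some $B\in\mathcal{B}$ with $B\subseteq^*A$, and $(\mathcal{B},\supseteq^* )$ is order-isomorphic to $\lambda_0\times\lambda_1$ with the coordinatewise order. An ultrafilter $U$ is $(\mu,\lambda)$-cohesive if for every family $\{X_\alpha:\alpha<\lambda\}$ of $\lambda$ many (distinct) members of $U$ there is $I\in[\lambda]^\mu$ such that $\bigcap_{i\in I}X_i\in U$. *)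

theory Defs
  imports Main
begin

unbundle cardinal_syntax

text \<open>
  A cardinal is represented, as in the library's theory of cardinals, by a relation \<open>r\<close> with
  \<open>Card_order r\<close>, i.e. a well-order of minimal length on its carrier \<open>Field r\<close>.  The elements of
  \<open>Field r\<close> play the role of the ordinals below the cardinal, and \<open>underS r b\<close> is the initial
  segment that the ordinal \<open>b\<close> is as a set.
\<close>

definition regular_cardinal :: "'a rel \<Rightarrow> bool" where
  "regular_cardinal r \<longleftrightarrow> Cinfinite r \<and> regularCard r"

definition ultrafilter_over :: "'a set \<Rightarrow> 'a set set \<Rightarrow> bool" where
  "ultrafilter_over S U \<longleftrightarrow>
     U \<subseteq> Pow S \<and> S \<in> U \<and> {} \<notin> U \<and>
     (\<forall>A B. A \<in> U \<and> A \<subseteq> B \<and> B \<subseteq> S \<longrightarrow> B \<in> U) \<and>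
     (\<forall>A B. A \<in> U \<and> B \<in> U \<longrightarrow> A \<inter> B \<in> U) \<and>
     (\<forall>A. A \<subseteq> S \<longrightarrow> A \<in> U \<or> S - A \<in> U)"

definition bounded_in :: "'k rel \<Rightarrow> 'k set \<Rightarrow> bool" where
  "bounded_in \<kappa> A \<longleftrightarrow> (\<exists>\<beta>\<in>Field \<kappa>. A \<subseteq> underS \<kappa> \<beta>)"

definition almost_subset :: "'k rel \<Rightarrow> 'k set \<Rightarrow> 'k set \<Rightarrow> bool" where
  "almost_subset \<kappa> A B \<longleftrightarrow> bounded_in \<kappa> (A - B)"

definition coordinatewise :: "'a rel \<Rightarrow> 'b rel \<Rightarrow> ('a \<times> 'b) rel" where
  "coordinatewise r s = {((a, b), (a', b')). (a, a') \<in> r \<and> (b, b') \<in> s}"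

definition simple_P_point ::
    "'k rel \<Rightarrow> 'a rel \<Rightarrow> 'b rel \<Rightarrow> 'k set set \<Rightarrow> bool" where
  "simple_P_point \<kappa> l\<^sub>0 l\<^sub>1 U \<longleftrightarrow>
     (\<exists>\<B>\<subseteq>U.
        (\<forall>A\<in>U. \<exists>B\<in>\<B>. almost_subset \<kappa> B A) \<and>
        (\<exists>f. bij_betw f (Field l\<^sub>0 \<times> Field l\<^sub>1) \<B> \<and>
             (\<forall>p\<in>Field l\<^sub>0 \<times> Field l\<^sub>1. \<forall>q\<in>Field l\<^sub>0 \<times> Field l\<^sub>1.
                (p, q) \<in> coordinatewise l\<^sub>0 l\<^sub>1 \<longleftrightarrow> almost_subset \<kappa> (f q) (f p))))"

text \<open>
  For infinite \<open>\<mu>\<close>, the only case of interest, \<open>I\<close> is nonempty, so that the intersection is a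
  subset of the set on which \<open>U\<close> lives.
\<close>

definition cohesive :: "'m rel \<Rightarrow> 'l rel \<Rightarrow> 'k set set \<Rightarrow> bool" where
  "cohesive \<mu> l U \<longleftrightarrow>
     (\<forall>X. inj_on X (Field l) \<and> X ` Field l \<subseteq> U \<longrightarrow>
        (\<exists>I\<subseteq>Field l. |I| =o \<mu> \<and> (\<Inter>i\<in>I. X i) \<in> U))"

end

(* Let f enumerate the base in the order of l\<^sub>0 \<times> l\<^sub>1.  An axis i \<mapsto> f (i, b) or j \<mapsto> f (a, j) is a
   family such that every member of U is almost contained in boundedly many of its sets only; hence
   no intersection of l\<^sub>0, respectively l\<^sub>1, many of them is in U.  For the positive part, given l\<^sub>1
   many sets X i in U, choose base sets f (a i, b i) almost contained in X i.  As l\<^sub>0 < l\<^sub>1, the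
   coordinate a i takes a constant value a' for l\<^sub>1 many i.  Among these take l\<^sub>0 many; their b i have
   an upper bound b' below l\<^sub>1, so f (a', b') is almost contained in all these X i.  As \<kappa> < l\<^sub>0, for
   l\<^sub>0 many of them the same bounded set of exceptions suffices. *)

theory Submission
  imports Defs
begin

text \<open>By regularity a cofinal subset has the full size of \<open>r\<close>, so
  \<open>B\<close> is not cofinal. As \<open>cofinal\<close> asks for strictly larger elements, some
  \<open>u\<close> has no element of \<open>B\<close> strictly above it, and totality makes it an
  upper bound.\<close>

lemma regular_cardinal_bound:
  assumes "regular_cardinal r" and "B \<subseteq> Field r" and "|B| <o r"
  obtains u where "u \<in> Field r" and "\<And>b. b \<in> B \<Longrightarrow> (b, u) \<in> r"
proof -
  have "wo_rel r"
    using assms(1) by (simp add: regular_cardinal_def card_order_on_def wo_rel_def)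
  have "\<not> cofinal B r"
    using assms not_ordLess_ordIso unfolding regular_cardinal_def regularCard_def by blast
  then obtain u where u: "u \<in> Field r" "\<And>b. b \<in> B \<Longrightarrow> u = b \<or> (u, b) \<notin> r"
    unfolding cofinal_def by blast
  have "(b, u) \<in> r" if "b \<in> B" for b
    using u(2)[OF that] u(1) that assms(2) wo_rel.TOTALS[OF \<open>wo_rel r\<close>] by blast
  with u(1) show thesis by (rule that)
qed

text \<open>An infinite cardinal has no largest element, so \<open>u\<close> can be raised to a
  strict bound \<open>v\<close>; the initial segment below \<open>v\<close> is smaller than the
  cardinal.\<close>

lemma Cinfinite_bounded_ordLess:
  assumes "Cinfinite r" and "u \<in> Field r" and "\<And>b. b \<in> B \<Longrightarrow> (b, u) \<in> r"
  shows "|B| <o r"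
proof -
  obtain v where v: "v \<in> Field r" "u \<noteq> v" "(u, v) \<in> r"
    using Cinfinite_limit assms(1,2) by metis
  have "wo_rel r"
    using assms(1) by (simp add: card_order_on_def wo_rel_def)
  then have "trans r" and "antisym r"
    by (auto intro: wo_rel.TRANS wo_rel.ANTISYM)
  then have "B \<subseteq> underS r v"
    using v assms(3) unfolding underS_def by (auto dest: transD antisymD)
  then have "|B| \<le>o |underS r v|"
    by (rule card_of_mono1)
  also have "|underS r v| <o r"
    using assms(1) v(1) by (simp add: card_of_underS)
  finally show ?thesis .
qed

text \<open>Regular cardinals are stable: a union of fewer than \<open>r\<close> sets, each smaller
  than \<open>r\<close>, is smaller than \<open>r\<close>. The fibres of \<open>g\<close> over
  \<open>C\<close> cover \<open>A\<close>, so they cannot all be small.\<close>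

lemma regular_cardinal_pigeonhole:
  assumes "regular_cardinal r" and "|A| =o r" and "|C| <o r" and "g ` A \<subseteq> C"
  obtains c where "c \<in> C" and "|{a \<in> A. g a = c}| =o r"
proof -
  have "stable r"
    using assms(1) regularCard_stable unfolding regular_cardinal_def cinfinite_def by blast
  have "\<exists>c\<in>C. \<not> |{a \<in> A. g a = c}| <o r"
  proof (rule ccontr)
    assume "\<not> ?thesis"
    then have "|\<Union>c\<in>C. {a \<in> A. g a = c}| <o r"
      by (intro stable_UNION[OF \<open>stable r\<close> assms(3)]) simp
    moreover have "(\<Union>c\<in>C. {a \<in> A. g a = c}) = A"
      using assms(4) by auto
    ultimately show False
      using assms(2) not_ordLess_ordIso by auto
  qed
  then obtain c where c: "c \<in> C" "\<not> |{a \<in> A. g a = c}| <o r"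
    by blast
  have "|{a \<in> A. g a = c}| \<le>o |A|"
    by (rule card_of_mono1) auto
  then have "|{a \<in> A. g a = c}| \<le>o r"
    using assms(2) by (rule ordLeq_ordIso_trans)
  with c that show thesis
    using ordLeq_iff_ordLess_or_ordIso by blast
qed

lemma bounded_in_subset:
  "bounded_in \<kappa> B \<Longrightarrow> A \<subseteq> B \<Longrightarrow> bounded_in \<kappa> A"
  unfolding bounded_in_def by blast

text \<open>Initial segments of a well-order are nested, so the larger of the two bounds serves both
  sets.\<close>

lemma bounded_in_Un:
  assumes "Well_order \<kappa>" and "bounded_in \<kappa> A" and "bounded_in \<kappa> B"
  shows "bounded_in \<kappa> (A \<union> B)"
proof -
  obtain \<alpha> \<beta> where *: "\<alpha> \<in> Field \<kappa>" "A \<subseteq> underS \<kappa> \<alpha>" "\<beta> \<in> Field \<kappa>" "B \<subseteq> underS \<kappa> \<beta>"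
    using assms(2,3) unfolding bounded_in_def by blast
  have "wo_rel \<kappa>"
    using assms(1) by (simp add: wo_rel_def)
  then have "trans \<kappa>" and "antisym \<kappa>" and "(\<alpha>, \<beta>) \<in> \<kappa> \<or> (\<beta>, \<alpha>) \<in> \<kappa>"
    using * by (auto intro: wo_rel.TRANS wo_rel.ANTISYM simp: wo_rel.TOTALS)
  then have "underS \<kappa> \<alpha> \<subseteq> underS \<kappa> \<beta> \<or> underS \<kappa> \<beta> \<subseteq> underS \<kappa> \<alpha>"
    by (metis underS_incr)
  with * show ?thesis
    unfolding bounded_in_def by blast
qed

text \<open>The difference \<open>A - C\<close> is covered by \<open>A - B\<close> and
  \<open>B - C\<close>.\<close>

lemma almost_subset_trans:
  assumes "Well_order \<kappa>" and "almost_subset \<kappa> A B" and "almost_subset \<kappa> B C"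
  shows "almost_subset \<kappa> A C"
  using bounded_in_Un[OF assms(1) assms(2,3)[unfolded almost_subset_def]]
  unfolding almost_subset_def by (rule bounded_in_subset) auto

text \<open>An intersection lies inside each of its sets. If it were in \<open>U\<close>, then
  \<open>bound\<close> would put all its indices below a single \<open>u\<close>, leaving fewer than
  \<open>r\<close> of them.\<close>

lemma not_cohesive:
  assumes "Cinfinite r" and "Field \<kappa> \<noteq> {}"
    and "inj_on X (Field r)" and "X ` Field r \<subseteq> U"
    and bound: "\<And>A. A \<in> U \<Longrightarrow>
      \<exists>u\<in>Field r. \<forall>i\<in>Field r. almost_subset \<kappa> A (X i) \<longrightarrow> (i, u) \<in> r"
  shows "\<not> cohesive r r U"
proof
  assume "cohesive r r U"
  then obtain I where I: "I \<subseteq> Field r" "|I| =o r" "(\<Inter>i\<in>I. X i) \<in> U"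
    using assms(3,4) unfolding cohesive_def by metis
  obtain u where u: "u \<in> Field r"
    "\<And>i. i \<in> Field r \<Longrightarrow> almost_subset \<kappa> (\<Inter>i\<in>I. X i) (X i) \<Longrightarrow> (i, u) \<in> r"
    using bound[OF I(3)] by blast
  have "(i, u) \<in> r" if "i \<in> I" for i
  proof (rule u(2))
    have "(\<Inter>i\<in>I. X i) - X i = {}"
      using that by blast
    \<comment> \<open>The empty difference is bounded because \<open>\<kappa>\<close> has some
      element to serve as the bound.\<close>
    then show "almost_subset \<kappa> (\<Inter>i\<in>I. X i) (X i)"
      using assms(2) unfolding almost_subset_def bounded_in_def by auto
  qed (use that I(1) in blast)
  then have "|I| <o r"
    using Cinfinite_bounded_ordLess[OF assms(1) u(1)] by blast
  with I(2) show False
    using not_ordLess_ordIso by blast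
qed

theorem theorem5p13:
  fixes \<kappa> :: "'k rel" and l\<^sub>0 :: "'a rel" and l\<^sub>1 :: "'b rel" and U :: "'k set set"
  assumes "regular_cardinal \<kappa>" and "regular_cardinal l\<^sub>0" and "regular_cardinal l\<^sub>1"
    and "\<kappa> <o l\<^sub>0" and "l\<^sub>0 <o l\<^sub>1"
    and "ultrafilter_over (Field \<kappa>) U"
    and "simple_P_point \<kappa> l\<^sub>0 l\<^sub>1 U"
  shows "\<not> cohesive l\<^sub>0 l\<^sub>0 U \<and> \<not> cohesive l\<^sub>1 l\<^sub>1 U \<and> cohesive l\<^sub>0 l\<^sub>1 U"
proof -
  have inf: "Cinfinite \<kappa>" "Cinfinite l\<^sub>0" "Cinfinite l\<^sub>1"
    using assms(1-3) by (simp_all add: regular_cardinal_def)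
  then have wo: "Well_order \<kappa>" and nonempty: "Field \<kappa> \<noteq> {}"
    and l0: "|Field l\<^sub>0| =o l\<^sub>0" and l1: "|Field l\<^sub>1| =o l\<^sub>1"
    by (auto simp: card_order_on_def cinfinite_def intro: card_of_Field_ordIso)
  \<comment> \<open>These fix the two axes along which cohesiveness will fail.\<close>
  obtain a\<^sub>0 b\<^sub>0 where a0: "a\<^sub>0 \<in> Field l\<^sub>0" and b0: "b\<^sub>0 \<in> Field l\<^sub>1"
    using inf unfolding cinfinite_def by (metis ex_in_conv finite.emptyI)
  have upward: "\<And>A B. A \<in> U \<Longrightarrow> A \<subseteq> B \<Longrightarrow> B \<subseteq> Field \<kappa> \<Longrightarrow> B \<in> U"
    and inter: "\<And>A B. A \<in> U \<Longrightarrow> B \<in> U \<Longrightarrow> A \<inter> B \<in> U"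
    and compl: "\<And>A. A \<subseteq> Field \<kappa> \<Longrightarrow> A \<in> U \<or> Field \<kappa> - A \<in> U"
    and U_sub: "\<And>A. A \<in> U \<Longrightarrow> A \<subseteq> Field \<kappa>"
    using assms(6)[unfolded ultrafilter_over_def] by (simp, simp, simp, auto)
  obtain \<B> f where \<B>: "\<B> \<subseteq> U" "\<And>A. A \<in> U \<Longrightarrow> \<exists>B\<in>\<B>. almost_subset \<kappa> B A"
    and bij: "bij_betw f (Field l\<^sub>0 \<times> Field l\<^sub>1) \<B>"
    and ord: "\<And>p q. p \<in> Field l\<^sub>0 \<times> Field l\<^sub>1 \<Longrightarrow> q \<in> Field l\<^sub>0 \<times> Field l\<^sub>1 \<Longrightarrow>
      (p, q) \<in> coordinatewise l\<^sub>0 l\<^sub>1 \<longleftrightarrow> almost_subset \<kappa> (f q) (f p)"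
    using assms(7) unfolding simple_P_point_def by metis
  have f_inj: "inj_on f (Field l\<^sub>0 \<times> Field l\<^sub>1)"
    and f_U: "\<And>a b. a \<in> Field l\<^sub>0 \<Longrightarrow> b \<in> Field l\<^sub>1 \<Longrightarrow> f (a, b) \<in> U"
    using bij \<B>(1) by (auto simp: bij_betw_def)
  have f_base: "\<exists>a\<in>Field l\<^sub>0. \<exists>b\<in>Field l\<^sub>1. almost_subset \<kappa> (f (a, b)) A" if "A \<in> U" for A
    using \<B>(2)[OF that] bij unfolding bij_betw_def by blast
  have f_ord: "almost_subset \<kappa> (f (a', b')) (f (a, b)) \<longleftrightarrow> (a, a') \<in> l\<^sub>0 \<and> (b, b') \<in> l\<^sub>1"
    if "a \<in> Field l\<^sub>0" "b \<in> Field l\<^sub>1" "a' \<in> Field l\<^sub>0" "b' \<in> Field l\<^sub>1" for a b a' b'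
    using ord[of "(a, b)" "(a', b')"] that by (auto simp: coordinatewise_def)
  \<comment> \<open>Take a base set \<open>f (a, b)\<close> almost contained in \<open>A\<close>.
    Any \<open>f (i, j)\<close> almost containing \<open>A\<close> also almost contains
    \<open>f (a, b)\<close>, and the order isomorphism then places \<open>(i, j)\<close> below
    \<open>(a, b)\<close>.\<close>
  have bound: "\<exists>a\<in>Field l\<^sub>0. \<exists>b\<in>Field l\<^sub>1. \<forall>i\<in>Field l\<^sub>0. \<forall>j\<in>Field l\<^sub>1.
      almost_subset \<kappa> A (f (i, j)) \<longrightarrow> (i, a) \<in> l\<^sub>0 \<and> (j, b) \<in> l\<^sub>1" if "A \<in> U" for A
  proof -
    obtain a b where "a \<in> Field l\<^sub>0" "b \<in> Field l\<^sub>1" "almost_subset \<kappa> (f (a, b)) A"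
      using f_base[OF \<open>A \<in> U\<close>] by blast
    moreover from this have "(i, a) \<in> l\<^sub>0 \<and> (j, b) \<in> l\<^sub>1"
      if "i \<in> Field l\<^sub>0" "j \<in> Field l\<^sub>1" "almost_subset \<kappa> A (f (i, j))" for i j
      using f_ord[of i j a b] almost_subset_trans[OF wo _ that(3)] that(1,2) by blast
    ultimately show ?thesis by blast
  qed
  have not0: "\<not> cohesive l\<^sub>0 l\<^sub>0 U"
  proof (rule not_cohesive[OF inf(2) nonempty])
    show "inj_on (\<lambda>i. f (i, b\<^sub>0)) (Field l\<^sub>0)"
      using f_inj b0 by (auto simp: inj_on_def)
    show "(\<lambda>i. f (i, b\<^sub>0)) ` Field l\<^sub>0 \<subseteq> U"
      using f_U b0 by blast
    show "\<exists>u\<in>Field l\<^sub>0. \<forall>i\<in>Field l\<^sub>0. almost_subset \<kappa> A (f (i, b\<^sub>0)) \<longrightarrow> (i, u) \<in> l\<^sub>0"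
      if "A \<in> U" for A
      using bound[OF that] b0 by blast
  qed
  have not1: "\<not> cohesive l\<^sub>1 l\<^sub>1 U"
  proof (rule not_cohesive[OF inf(3) nonempty])
    show "inj_on (\<lambda>j. f (a\<^sub>0, j)) (Field l\<^sub>1)"
      using f_inj a0 by (auto simp: inj_on_def)
    show "(\<lambda>j. f (a\<^sub>0, j)) ` Field l\<^sub>1 \<subseteq> U"
      using f_U a0 by blast
    show "\<exists>u\<in>Field l\<^sub>1. \<forall>j\<in>Field l\<^sub>1. almost_subset \<kappa> A (f (a\<^sub>0, j)) \<longrightarrow> (j, u) \<in> l\<^sub>1"
      if "A \<in> U" for A
      using bound[OF that] a0 by blast
  qed
  \<comment> \<open>A bounded member of \<open>U\<close> would be almost contained in every base set, so \<open>l\<^sub>0\<close> would have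
    a largest element.\<close>
  have unbounded: "\<not> bounded_in \<kappa> A" if "A \<in> U" for A
  proof
    assume "bounded_in \<kappa> A"
    then have "almost_subset \<kappa> A B" for B
      unfolding almost_subset_def by (rule bounded_in_subset) blast
    then obtain a where "a \<in> Field l\<^sub>0" "\<forall>i\<in>Field l\<^sub>0. (i, a) \<in> l\<^sub>0"
      using bound[OF \<open>A \<in> U\<close>] b0 by blast
    then have "|Field l\<^sub>0| <o l\<^sub>0"
      using Cinfinite_bounded_ordLess[OF inf(2)] by blast
    with l0 show False
      using not_ordLess_ordIso by blast
  qed
  \<comment> \<open>Deleting an initial segment from a base set will turn almost containment into
    true containment without leaving \<open>U\<close>.\<close>
  have cobounded: "A - underS \<kappa> \<gamma> \<in> U" if "A \<in> U" "\<gamma> \<in> Field \<kappa>" for A \<gamma>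
  proof -
    have "underS \<kappa> \<gamma> \<subseteq> Field \<kappa>"
      by (auto simp: underS_def Field_def)
    moreover have "underS \<kappa> \<gamma> \<notin> U"
      using unbounded that(2) unfolding bounded_in_def by blast
    ultimately have "A \<inter> (Field \<kappa> - underS \<kappa> \<gamma>) \<in> U"
      using compl[of "underS \<kappa> \<gamma>"] inter[OF that(1)] by blast
    moreover have "A \<inter> (Field \<kappa> - underS \<kappa> \<gamma>) = A - underS \<kappa> \<gamma>"
      using U_sub[OF that(1)] by blast
    ultimately show ?thesis by simp
  qed
  have "cohesive l\<^sub>0 l\<^sub>1 U"
    unfolding cohesive_def
  proof (intro allI impI)
    fix X :: "'b \<Rightarrow> 'k set"
    assume "inj_on X (Field l\<^sub>1) \<and> X ` Field l\<^sub>1 \<subseteq> U"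
    then have X: "X i \<in> U" if "i \<in> Field l\<^sub>1" for i
      using that by blast
    have "\<forall>i\<in>Field l\<^sub>1. \<exists>a b. a \<in> Field l\<^sub>0 \<and> b \<in> Field l\<^sub>1 \<and> almost_subset \<kappa> (f (a, b)) (X i)"
      using f_base[OF X] by blast
    then obtain a b where ab: "\<And>i. i \<in> Field l\<^sub>1 \<Longrightarrow>
        a i \<in> Field l\<^sub>0 \<and> b i \<in> Field l\<^sub>1 \<and> almost_subset \<kappa> (f (a i, b i)) (X i)"
      by metis
    have "a ` Field l\<^sub>1 \<subseteq> Field l\<^sub>0"
      using ab by blast
    then obtain a' where a': "a' \<in> Field l\<^sub>0" "|{i \<in> Field l\<^sub>1. a i = a'}| =o l\<^sub>1"
      by (rule regular_cardinal_pigeonhole[OF assms(3) l1 ordLess_Field[OF assms(5)]])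
    \<comment> \<open>The fibre over \<open>a'\<close> has size \<open>l\<^sub>1\<close>, so a
      subset \<open>J\<close> of size \<open>l\<^sub>0\<close> can be cut out of it.\<close>
    have "|Field l\<^sub>0| \<le>o |{i \<in> Field l\<^sub>1. a i = a'}|"
      by (rule ordLeq_ordIso_trans[OF ordLess_imp_ordLeq[OF ordLess_Field[OF assms(5)]]
            ordIso_symmetric[OF a'(2)]])
    from iffD1[OF internalize_card_of_ordLeq2 this]
    obtain J where J: "J \<subseteq> {i \<in> Field l\<^sub>1. a i = a'}" "|Field l\<^sub>0| =o |J|"
      by (elim exE conjE)
    have J_card: "|J| =o l\<^sub>0"
      by (rule ordIso_transitive[OF ordIso_symmetric[OF J(2)] l0])
    then have "|b ` J| <o l\<^sub>1"
      by (rule ordLeq_ordLess_trans[OF card_of_image ordIso_ordLess_trans[OF _ assms(5)]])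
    moreover have "b ` J \<subseteq> Field l\<^sub>1"
      using J(1) ab by blast
    ultimately obtain b' where b': "b' \<in> Field l\<^sub>1" "\<And>i. i \<in> J \<Longrightarrow> (b i, b') \<in> l\<^sub>1"
      using regular_cardinal_bound[OF assms(3)] by (metis imageI)
    \<comment> \<open>Reflexivity at \<open>a'\<close> reduces comparing \<open>(a', b i)\<close>
      with \<open>(a', b')\<close> to the second coordinate.\<close>
    have "(a', a') \<in> l\<^sub>0"
      using inf(2) a'(1) wo_rel.TOTALS[of l\<^sub>0] by (auto simp: card_order_on_def wo_rel_def)
    have "almost_subset \<kappa> (f (a', b')) (X i)" if "i \<in> J" for i
    proof (rule almost_subset_trans[OF wo])
      have i: "i \<in> Field l\<^sub>1" "a i = a'"
        using that J(1) by auto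
      show "almost_subset \<kappa> (f (a', b')) (f (a', b i))"
        using f_ord a'(1) b' that ab[OF i(1)] \<open>(a', a') \<in> l\<^sub>0\<close> by blast
      show "almost_subset \<kappa> (f (a', b i)) (X i)"
        using ab[OF i(1)] i(2) by simp
    qed
    \<comment> \<open>\<open>g i\<close> bounds the exceptional points for \<open>X i\<close>. With
      at most \<open>\<kappa>\<close> possible values and \<open>l\<^sub>0\<close> regular, one
      value \<open>\<gamma>\<close> is taken \<open>l\<^sub>0\<close> many times.\<close>
    then obtain g where g: "\<And>i. i \<in> J \<Longrightarrow>
        g i \<in> Field \<kappa> \<and> f (a', b') - X i \<subseteq> underS \<kappa> (g i)"
      unfolding almost_subset_def bounded_in_def by metis
    then have "g ` J \<subseteq> Field \<kappa>"
      by blast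
    then obtain \<gamma> where \<gamma>: "\<gamma> \<in> Field \<kappa>" "|{i \<in> J. g i = \<gamma>}| =o l\<^sub>0"
      by (rule regular_cardinal_pigeonhole[OF assms(2) J_card ordLess_Field[OF assms(4)]])
    define I where "I = {i \<in> J. g i = \<gamma>}"
    have I: "I \<subseteq> Field l\<^sub>1" "|I| =o l\<^sub>0"
      using J(1) \<gamma>(2) by (auto simp: I_def)
    \<comment> \<open>An empty \<open>I\<close> would make the intersection the whole type;
      nonemptiness keeps it inside \<open>Field \<kappa>\<close>, as upward closure of
      \<open>U\<close> requires.\<close>
    have "|Field l\<^sub>0| =o |I|"
      by (rule ordIso_transitive[OF l0 ordIso_symmetric[OF I(2)]])
    then have "I \<noteq> {}"
      using card_of_empty2 a0 by blast
    then have "(\<Inter>i\<in>I. X i) \<subseteq> Field \<kappa>"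
      using I(1) X U_sub by blast
    moreover have "f (a', b') - underS \<kappa> \<gamma> \<subseteq> (\<Inter>i\<in>I. X i)"
      using g by (auto simp: I_def)
    ultimately have "(\<Inter>i\<in>I. X i) \<in> U"
      using upward cobounded[OF f_U[OF a'(1) b'(1)] \<gamma>(1)] by blast
    with I show "\<exists>I\<subseteq>Field l\<^sub>1. |I| =o l\<^sub>0 \<and> (\<Inter>i\<in>I. X i) \<in> U"
      by blast
  qed
  with not0 not1 show ?thesis by blast
qed

end
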